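(* Let $(\hat u,\hat v)\in\mathcal{F}$ be a feasible point of the bilevel problem and let $\rho>0$ be sufficiently small (i.e., the following holds for all $\rho\in(0,\rho_0]$, for some $\rho_0>0$). Suppose $(\hat u,\hat v)\in\mathcal{K}_{\hat J}$ for some $\hat J\in\mathcal{P}$. If $\varphi_J\ge 0$ for all $J\in\mathcal{P}$ such that $J\subseteq\mathcal{I}(\hat u,\hat v)\cup\hat J$, then $(\hat u,\hat v)$ is a local minimizer of the bilevel problem.
   Context: Let $n,p,m$ be positive integers, $[m]=\{1,\dots,m\}$, and let $\mathcal{I}_1$ be a finite (possibly empty) index set. Let $F,f,h_i$ ($i\in\mathcal{I}_1$) be real polynomials in $(x,y)\in\mathbb{R}^n\times\mathbb{R}^p$, let $a_1,\dots,a_m\in\mathbb{R}^p$ be constant vectors and $b_1,\dots,b_m$ real polynomials in $x\in\mathbb{R}^n$. Let $A\in\mathbb{R}^{m\times p}$ be the matrix with rows $a_1^T,\dots,a_m^T$, $b(x)=(b_1(x),\dots,b_m(x))^T$, and $t=\operatorname{rank}A$. For $x\in\mathbb{R}^n$ let $Z(x)=\{y\in\mathbb{R}^p : Ay-b(x)\ge 0\}$ and let $S(x)$ be the set of global minimizers of $f(x,\cdot)$ over $Z(x)$. Put $$\mathcal{U}=\{(x,y) : h_i(x,y)\ge 0\ (i\in\mathcal{I}_1),\ a_j^Ty-b_j(x)\ge 0\ (j\in[m])\},\qquad \mathcal{F}=\{(x,y)\in\mathcal{U} : y\in S(x)\}.$$ The bilevel problem is: minimize $F(x,y)$ over $(x,y)\in\mathcal{F}$.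 A point of $\mathcal{F}$ is a local minimizer if it minimizes $F$ over $\mathcal{F}\cap B$ for some ball $B$ of positive radius centered at the point. Standing assumption: $S(x)\neq\emptyset$ for every $x$ such that $(x,y)\in\mathcal{U}$ for some $y$. For $J\subseteq[m]$, $A_J$ denotes the submatrix of $A$ with rows $a_j^T$, $j\in J$. Let $\mathcal{P}=\{J\subseteq[m] : |J|=t,\ A_J\text{ has full rank}\}$. For $J\in\mathcal{P}$, $\mathcal{K}_J$ is the set of all $(x,y)\in\mathcal{U}$ for which there exists $\lambda_J=(\lambda_j)_{j\in J}$ with $\nabla_yf(x,y)-A_J^T\lambda_J=0$ and, for all $j\in J$, $a_j^Ty-b_j(x)\ge0$, $\lambda_j\ge0$, $\lambda_j\,(a_j^Ty-b_j(x))=0$. The active index set at $(x,y)$ is $\mathcal{I}(x,y)=\{j\in[m] : a_j^Ty=b_j(x)\}$. $B_\rho(\hat u,\hat v)$ is the closed Euclidean ball of radius $\rho$ centered at $(\hat u,\hat v)$. For $J\in\mathcal{P}$, $\varphi_J$ (depending on $\rho$ and $(\hat u,\hat v)$) is the optimal value of the problem: minimize $F(x,y)-F(\hat u,\hat v)$ over $(x,y)\in\mathcal{K}_J\cap B_\rho(\hat u,\hat v)$ (equal to $+\infty$ if this set is empty). *)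

theory Defs
  imports "HOL-Analysis.Analysis"
begin

text \<open>
  The lower-level constraints are given by vectors \<open>a j\<close> and functions \<open>b j\<close>, with \<open>j\<close> ranging over
  a finite index type \<open>'m\<close> that plays the role of \<open>[m]\<close>; the dimensions of \<open>x\<close> and \<open>y\<close> are the
  cardinalities of \<open>'n\<close> and \<open>'p\<close>. The norm on \<open>(real^'n) \<times> (real^'p)\<close> is the Euclidean norm of the
  product.
\<close>

definition row_matrix :: "('m::finite \<Rightarrow> real^'p) \<Rightarrow> real^'p^'m" where
  "row_matrix a = (\<chi> j. a j)"

definition lower_feasible ::
    "('m::finite \<Rightarrow> real^'p) \<Rightarrow> ('m \<Rightarrow> real^'n \<Rightarrow> real) \<Rightarrow> real^'n \<Rightarrow> (real^'p) set" where
  "lower_feasible a b x = {y. \<forall>j. (row_matrix a *v y - (\<chi> i. b i x)) $ j \<ge> 0}"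

definition lower_solutions ::
    "((real^'n) \<times> (real^'p) \<Rightarrow> real) \<Rightarrow> ('m::finite \<Rightarrow> real^'p) \<Rightarrow> ('m \<Rightarrow> real^'n \<Rightarrow> real)
      \<Rightarrow> real^'n \<Rightarrow> (real^'p) set" where
  "lower_solutions f a b x = {y. is_arg_min (\<lambda>z. f (x, z)) (\<lambda>z. z \<in> lower_feasible a b x) y}"

definition constraint_set ::
    "'i set \<Rightarrow> ('i \<Rightarrow> (real^'n) \<times> (real^'p) \<Rightarrow> real) \<Rightarrow> ('m::finite \<Rightarrow> real^'p)
      \<Rightarrow> ('m \<Rightarrow> real^'n \<Rightarrow> real) \<Rightarrow> ((real^'n) \<times> (real^'p)) set" where
  "constraint_set I\<^sub>1 h a b =
     {(x, y). (\<forall>i\<in>I\<^sub>1. h i (x, y) \<ge> 0) \<and> (\<forall>j. a j \<bullet> y - b j x \<ge> 0)}"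

definition bilevel_feasible ::
    "((real^'n) \<times> (real^'p) \<Rightarrow> real) \<Rightarrow> 'i set \<Rightarrow> ('i \<Rightarrow> (real^'n) \<times> (real^'p) \<Rightarrow> real)
      \<Rightarrow> ('m::finite \<Rightarrow> real^'p) \<Rightarrow> ('m \<Rightarrow> real^'n \<Rightarrow> real) \<Rightarrow> ((real^'n) \<times> (real^'p)) set" where
  "bilevel_feasible f I\<^sub>1 h a b =
     {(x, y). (x, y) \<in> constraint_set I\<^sub>1 h a b \<and> y \<in> lower_solutions f a b x}"

definition local_minimizer :: "('a::metric_space \<Rightarrow> real) \<Rightarrow> 'a set \<Rightarrow> 'a \<Rightarrow> bool" where
  "local_minimizer g S w \<longleftrightarrow> (\<exists>\<epsilon>>0. is_arg_min g (\<lambda>z. z \<in> S \<inter> cball w \<epsilon>) w)"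

text \<open>
  The type of a matrix fixes its number of rows, so the submatrix \<open>A\<^sub>J\<close> is represented by its family
  of rows \<open>a j\<close>, \<open>j \<in> J\<close>. Its rank is the dimension of the set of its rows (as in \<open>row_rank_def\<close>),
  and full rank means the largest rank possible for a matrix with \<open>card J\<close> rows and \<open>CARD('p)\<close>
  columns.
\<close>

definition submatrix_rank :: "('m::finite \<Rightarrow> real^'p) \<Rightarrow> 'm set \<Rightarrow> nat" where
  "submatrix_rank a J = dim (a ` J)"

definition basis_sets :: "('m::finite \<Rightarrow> real^'p) \<Rightarrow> 'm set set" where
  "basis_sets a =
     {J. card J = rank (row_matrix a) \<and> submatrix_rank a J = min (card J) CARD('p)}"

definition gradient :: "('a::real_inner \<Rightarrow> real) \<Rightarrow> 'a \<Rightarrow> 'a" where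
  "gradient g y = (THE D. GDERIV g y :> D)"

lemma gradient_eq:
  assumes "GDERIV g y :> D"
  shows "gradient g y = D"
  unfolding gradient_def
proof (rule the_equality)
  fix D' assume "GDERIV g y :> D'"
  with assms have "(\<lambda>h. h \<bullet> D') = (\<lambda>h. h \<bullet> D)"
    unfolding gderiv_def by (rule has_derivative_unique[rotated])
  then show "D' = D"
    by (metis inner_commute vector_eq_ldot)
qed (rule assms)

text \<open>
  The sum \<open>\<Sum>j\<in>J. \<mu> j *\<^sub>R a j\<close> is the product of the transpose of \<open>A\<^sub>J\<close> with \<open>\<mu>\<^sub>J\<close>; the values of
  \<open>\<mu>\<close> outside \<open>J\<close> are irrelevant.
\<close>

definition KKT_set ::
    "((real^'n) \<times> (real^'p) \<Rightarrow> real) \<Rightarrow> 'i set \<Rightarrow> ('i \<Rightarrow> (real^'n) \<times> (real^'p) \<Rightarrow> real)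
      \<Rightarrow> ('m::finite \<Rightarrow> real^'p) \<Rightarrow> ('m \<Rightarrow> real^'n \<Rightarrow> real) \<Rightarrow> 'm set
      \<Rightarrow> ((real^'n) \<times> (real^'p)) set" where
  "KKT_set f I\<^sub>1 h a b J =
     {(x, y). (x, y) \<in> constraint_set I\<^sub>1 h a b \<and>
        (\<exists>\<mu> :: 'm \<Rightarrow> real.
           gradient (\<lambda>z. f (x, z)) y - (\<Sum>j\<in>J. \<mu> j *\<^sub>R a j) = 0 \<and>
           (\<forall>j\<in>J. a j \<bullet> y - b j x \<ge> 0 \<and> \<mu> j \<ge> 0 \<and> \<mu> j * (a j \<bullet> y - b j x) = 0))}"

definition active_set ::
    "('m::finite \<Rightarrow> real^'p) \<Rightarrow> ('m \<Rightarrow> real^'n \<Rightarrow> real) \<Rightarrow> (real^'n) \<times> (real^'p) \<Rightarrow> 'm set" where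
  "active_set a b w = {j. a j \<bullet> snd w = b j (fst w)}"

text \<open>In \<open>ereal\<close> the infimum of the empty set is \<open>\<infinity>\<close>.\<close>

definition branch_value ::
    "((real^'n) \<times> (real^'p) \<Rightarrow> real) \<Rightarrow> ((real^'n) \<times> (real^'p) \<Rightarrow> real) \<Rightarrow> 'i set
      \<Rightarrow> ('i \<Rightarrow> (real^'n) \<times> (real^'p) \<Rightarrow> real) \<Rightarrow> ('m::finite \<Rightarrow> real^'p)
      \<Rightarrow> ('m \<Rightarrow> real^'n \<Rightarrow> real) \<Rightarrow> real \<Rightarrow> (real^'n) \<times> (real^'p) \<Rightarrow> 'm set \<Rightarrow> ereal" where
  "branch_value F f I\<^sub>1 h a b \<rho> w J =
     (INF z \<in> KKT_set f I\<^sub>1 h a b J \<inter> cball w \<rho>. ereal (F z - F w))"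

end

theory Submission
  imports Defs
begin

text \<open>
  The point is that, near \<open>(u, v)\<close>, the bilevel feasible set is covered by those KKT branches whose
  index set lies in \<open>active_set a b (u, v) \<union> J'\<close>; on the part of each of them
  in the ball of radius \<open>\<rho>\<close>, \<open>F\<close> is at least \<open>F (u, v)\<close> by hypothesis.

  To see this, take a feasible point \<open>(x, y)\<close>. As \<open>y\<close> minimizes \<open>f (x, \<cdot>)\<close> over a polyhedron, no
  direction that stays feasible to first order is a descent direction, so by Farkas' lemma
  the gradient lies in the cone generated by the active rows
  (\<open>lower_solution_gradient_in_active_cone\<close>). By the conic version of Caratheodory's theorem
  (\<open>conic_combination_independent\<close>) linearly independent active rows suffice. The rows
  indexed by \<open>J'\<close> span the row space, so these independent rows can be completed by rows from \<open>J'\<close>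
  to a basis of it (\<open>exchange_into_basis_set\<close>). Giving the added rows multiplier zero
  preserves the KKT conditions, so \<open>(x, y)\<close> lies in a branch \<open>J \<subseteq> active_set a b (x, y) \<union> J'\<close>
  (\<open>bilevel_feasible_in_KKT_set\<close>). Finally, a constraint that is inactive at \<open>(u, v)\<close> stays
  inactive nearby, so \<open>active_set a b (x, y) \<subseteq> active_set a b (u, v)\<close> on a small ball whose
  radius depends on neither \<open>J'\<close> nor \<open>J\<close>.
\<close>

section \<open>Finitely generated cones\<close>

text \<open>
  Caratheodory's theorem for cones. Along a linear dependence the coefficients can be moved without
  changing the sum; stopping when the first of them reaches zero removes one vector and keeps the
  others nonnegative.
\<close>

lemma conic_combination_independent:
  fixes T :: "'a::real_vector set"
  assumes "finite T" and "\<And>w. w \<in> T \<Longrightarrow> 0 \<le> c w"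
  shows "\<exists>B c'. B \<subseteq> T \<and> independent B \<and> (\<forall>w\<in>B. 0 \<le> c' w)
           \<and> (\<Sum>w\<in>T. c w *\<^sub>R w) = (\<Sum>w\<in>B. c' w *\<^sub>R w)"
  using assms
proof (induction T arbitrary: c rule: finite_psubset_induct)
  case (psubset T)
  show ?case
  proof (cases "independent T")
    case True
    with psubset.prems show ?thesis by blast
  next
    case False
    then obtain d0 v0 where d0: "v0 \<in> T" "d0 v0 \<noteq> 0" "(\<Sum>w\<in>T. d0 w *\<^sub>R w) = 0"
      using dependent_finite[OF psubset.hyps(1)] by blast
    \<comment> \<open>The sign is chosen so that some coefficient of the dependence is positive.\<close>
    define d where "d w = sgn (d0 v0) * d0 w" for w
    have d: "(\<Sum>w\<in>T. d w *\<^sub>R w) = 0" "d v0 > 0"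
    proof -
      have "(\<Sum>w\<in>T. d w *\<^sub>R w) = sgn (d0 v0) *\<^sub>R (\<Sum>w\<in>T. d0 w *\<^sub>R w)"
        by (simp add: d_def scaleR_sum_right)
      then show "(\<Sum>w\<in>T. d w *\<^sub>R w) = 0" by (simp add: d0)
      show "d v0 > 0" using d0(2) by (auto simp: d_def sgn_if)
    qed
    define P where "P = {w \<in> T. d w > 0}"
    have P: "finite P" "P \<noteq> {}"
      using psubset.hyps(1) d0(1) d(2) by (auto simp: P_def)
    then obtain w0 where w0: "w0 \<in> P" and
      min: "\<And>w. w \<in> P \<Longrightarrow> c w0 / d w0 \<le> c w / d w"
      using arg_min_if_finite(1)[of P "\<lambda>w. c w / d w"] arg_min_least[of P _ "\<lambda>w. c w / d w"]
      by metis
    \<comment> \<open>The largest step along \<open>d\<close> that keeps all coefficients nonnegative; it annihilates \<open>w0\<close>.\<close>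
    define t where "t = c w0 / d w0"
    define c1 where "c1 w = c w - t * d w" for w
    have t: "t \<ge> 0"
      using w0 psubset.prems by (auto simp: t_def P_def)
    have c1: "0 \<le> c1 w" if "w \<in> T" for w
    proof (cases "d w > 0")
      case True
      then have "t \<le> c w / d w" using min that by (auto simp: t_def P_def)
      with True show ?thesis by (simp add: c1_def field_simps)
    next
      case False
      then have "t * d w \<le> 0" using t by (simp add: mult_nonneg_nonpos)
      with psubset.prems[OF that] show ?thesis by (simp add: c1_def)
    qed
    have c10: "c1 w0 = 0" using w0 by (simp add: c1_def t_def P_def)
    have "(\<Sum>w\<in>T. c1 w *\<^sub>R w) = (\<Sum>w\<in>T. c w *\<^sub>R w) - t *\<^sub>R (\<Sum>w\<in>T. d w *\<^sub>R w)"
      by (simp add: c1_def scaleR_diff_left sum_subtractf scaleR_sum_right)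
    also have "\<dots> = (\<Sum>w\<in>T. c w *\<^sub>R w)" by (simp add: d)
    also have "(\<Sum>w\<in>T. c1 w *\<^sub>R w) = (\<Sum>w\<in>T - {w0}. c1 w *\<^sub>R w)"
      using w0 psubset.hyps(1) by (simp add: sum.remove[of T w0] P_def c10)
    finally have eq: "(\<Sum>w\<in>T. c w *\<^sub>R w) = (\<Sum>w\<in>T - {w0}. c1 w *\<^sub>R w)" ..
    have "T - {w0} \<subset> T" using w0 by (auto simp: P_def)
    from psubset.IH[OF this, of c1] c1 eq show ?thesis
      by (metis Diff_iff Diff_subset order_trans)
  qed
qed

lemma convex_cone_hull_finite_subset:
  fixes V :: "'a::real_vector set"
  assumes "finite V"
  shows "convex_cone hull V \<subseteq> {\<Sum>w\<in>V. c w *\<^sub>R w | c. \<forall>w\<in>V. 0 \<le> c w}"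
    (is "_ \<subseteq> ?C")
proof (rule hull_minimal)
  show "V \<subseteq> ?C"
  proof
    fix v assume "v \<in> V"
    then have "v = (\<Sum>w\<in>V. (if w = v then 1 else 0) *\<^sub>R w)"
      using assms by (simp add: if_distrib[of "\<lambda>r. r *\<^sub>R _"] sum.delta cong: if_cong)
    then show "v \<in> ?C" by (intro CollectI exI[of _ "\<lambda>w. if w = v then 1 else 0"]) simp
  qed
  show "convex_cone ?C"
    unfolding convex_cone_iff
  proof (intro conjI ballI allI impI)
    show "0 \<in> ?C" by (intro CollectI exI[of _ "\<lambda>_. 0"]) simp
  next
    fix x y assume "x \<in> ?C" "y \<in> ?C"
    then obtain c d where "x = (\<Sum>w\<in>V. c w *\<^sub>R w)" "\<forall>w\<in>V. 0 \<le> c w"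
      "y = (\<Sum>w\<in>V. d w *\<^sub>R w)" "\<forall>w\<in>V. 0 \<le> d w" by blast
    then show "x + y \<in> ?C"
      by (intro CollectI exI[of _ "\<lambda>w. c w + d w"]) (simp add: scaleR_add_left sum.distrib)
  next
    fix x and r :: real assume "x \<in> ?C" "0 \<le> r"
    then obtain c where "x = (\<Sum>w\<in>V. c w *\<^sub>R w)" "\<forall>w\<in>V. 0 \<le> c w" by blast
    with \<open>0 \<le> r\<close> show "r *\<^sub>R x \<in> ?C"
      by (intro CollectI exI[of _ "\<lambda>w. r * c w"]) (simp add: scaleR_sum_right)
  qed
qed

text \<open>
  Farkas' lemma. A finitely generated cone is closed, so a point outside it can be strictly separated
  from it. A functional that is bounded below on a cone is nonnegative there, and the separating
  functional is negative at the point because the cone contains \<open>0\<close>.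
\<close>

lemma Farkas_convex_cone_hull:
  fixes V :: "'a::euclidean_space set"
  assumes "finite V"
    and dual: "\<And>d. (\<And>w. w \<in> V \<Longrightarrow> 0 \<le> w \<bullet> d) \<Longrightarrow> 0 \<le> g \<bullet> d"
  shows "g \<in> convex_cone hull V"
proof (rule ccontr)
  let ?K = "convex_cone hull V"
  assume "g \<notin> ?K"
  then obtain d r where g: "d \<bullet> g < r" and K: "\<And>x. x \<in> ?K \<Longrightarrow> r < d \<bullet> x"
    using separating_hyperplane_closed_point[OF convex_convex_cone_hull closed_convex_cone_hull]
      assms(1) by metis
  have r: "r < 0" using K[OF convex_cone_hull_contains_0] by simp
  have "0 \<le> w \<bullet> d" if "w \<in> V" for w
  proof (rule ccontr)
    assume neg: "\<not> 0 \<le> w \<bullet> d"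
    \<comment> \<open>This multiple of \<open>w\<close> sits exactly on the separating hyperplane.\<close>
    have "(r / (w \<bullet> d)) *\<^sub>R w \<in> ?K"
      using neg r that by (intro convex_cone_hull_mul hull_inc) (auto simp: divide_nonpos_nonpos)
    from K[OF this] neg show False by (simp add: inner_commute)
  qed
  then have "0 \<le> g \<bullet> d" by (rule dual)
  with g r show False by (simp add: inner_commute)
qed

section \<open>Optimality over a polyhedron\<close>

text \<open>
  For affine constraints, being feasible to first order at the active constraints implies being
  feasible for all small steps: the inactive constraints have slack.
\<close>

lemma minimizer_over_polyhedron_derivative_nonneg:
  fixes \<phi> :: "'a::euclidean_space \<Rightarrow> real" and a :: "'m \<Rightarrow> 'a"
  assumes "finite J"
    and feas: "\<And>j. j \<in> J \<Longrightarrow> \<beta> j \<le> a j \<bullet> y"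
    and min: "\<And>z. (\<And>j. j \<in> J \<Longrightarrow> \<beta> j \<le> a j \<bullet> z) \<Longrightarrow> \<phi> y \<le> \<phi> z"
    and deriv: "GDERIV \<phi> y :> g"
    and d: "\<And>j. j \<in> J \<Longrightarrow> a j \<bullet> y = \<beta> j \<Longrightarrow> 0 \<le> a j \<bullet> d"
  shows "0 \<le> g \<bullet> d"
proof (rule ccontr)
  assume "\<not> 0 \<le> g \<bullet> d"
  have "(\<phi> has_derivative (\<lambda>k. k \<bullet> g)) (at (y + 0 *\<^sub>R d))"
    using deriv by (simp add: gderiv_def)
  moreover have "((\<lambda>t::real. y + t *\<^sub>R d) has_derivative (\<lambda>t. t *\<^sub>R d)) (at 0)"
    by (auto intro!: derivative_eq_intros)
  ultimately have "((\<lambda>t. \<phi> (y + t *\<^sub>R d)) has_derivative (\<lambda>t. (t *\<^sub>R d) \<bullet> g)) (at 0)"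
    by (rule has_derivative_compose[rotated])
  then have "((\<lambda>t. \<phi> (y + t *\<^sub>R d)) has_real_derivative g \<bullet> d) (at 0)"
    by (simp add: has_derivative_imp_has_field_derivative inner_commute)
  from DERIV_neg_dec_right[OF this] \<open>\<not> 0 \<le> g \<bullet> d\<close>
  have dec: "eventually (\<lambda>t. \<phi> (y + t *\<^sub>R d) < \<phi> y) (at_right 0)"
    by (auto simp: eventually_at_right)
  have ev: "eventually (\<lambda>t. \<beta> j \<le> a j \<bullet> (y + t *\<^sub>R d)) (at_right 0)" if j: "j \<in> J" for j
  proof (cases "a j \<bullet> y = \<beta> j")
    case True
    then show ?thesis
      using d[OF j True]
      by (intro eventually_mono[OF eventually_at_right_less]) (simp add: inner_add_right)
  next
    case False
    have "((\<lambda>t. a j \<bullet> (y + t *\<^sub>R d)) \<longlongrightarrow> a j \<bullet> (y + 0 *\<^sub>R d)) (at_right 0)"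
      by (intro tendsto_intros)
    then have "eventually (\<lambda>t. \<beta> j < a j \<bullet> (y + t *\<^sub>R d)) (at_right 0)"
      using feas[OF j] False by (intro order_tendstoD) auto
    then show ?thesis by (rule eventually_mono) simp
  qed
  have "eventually (\<lambda>t. \<forall>j\<in>J. \<beta> j \<le> a j \<bullet> (y + t *\<^sub>R d)) (at_right 0)"
    using assms(1) ev by (simp add: eventually_ball_finite)
  with dec have "eventually (\<lambda>t::real. False) (at_right 0)"
  proof eventually_elim
    case (elim t)
    then show False using min[of "y + t *\<^sub>R d"] by fastforce
  qed
  then show False by simp
qed

lemma real_polynomial_function_GDERIV:
  fixes p :: "'a::euclidean_space \<Rightarrow> real"
  assumes "real_polynomial_function p"
  obtains g where "GDERIV p y :> g"
proof -
  have "p differentiable (at y)"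
    using assms by (simp add: differentiable_at_polynomial_function real_polynomial_function_eq)
  then obtain D where D: "(p has_derivative D) (at y)"
    unfolding differentiable_def by blast
  have "D k = k \<bullet> adjoint D 1" for k
    using adjoint_works[OF has_derivative_linear[OF D], of k 1] by simp
  then have "D = (\<lambda>k. k \<bullet> adjoint D 1)" by blast
  with D that show thesis by (metis gderiv_def)
qed

lemma lower_solution_gradient_in_active_cone:
  fixes f :: "(real^'n) \<times> (real^'p) \<Rightarrow> real" and a :: "'m::finite \<Rightarrow> real^'p"
  assumes f: "real_polynomial_function f"
    and y: "y \<in> lower_solutions f a b x"
  shows "gradient (\<lambda>z. f (x, z)) y \<in> convex_cone hull (a ` active_set a b (x, y))"
proof -
  have "polynomial_function (\<lambda>z::real^'p. (x, 0) + (0::real^'n, z))"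
    by (intro polynomial_function_add polynomial_function_const polynomial_function_bounded_linear
        bounded_linear_Pair bounded_linear_zero bounded_linear_ident)
  from real_polynomial_function_compose[OF this f]
  have "real_polynomial_function (\<lambda>z. f (x, z))" by (simp add: o_def)
  then obtain g where g: "GDERIV (\<lambda>z. f (x, z)) y :> g"
    using real_polynomial_function_GDERIV by blast
  have feas: "z \<in> lower_feasible a b x \<longleftrightarrow> (\<forall>j\<in>UNIV. b j x \<le> a j \<bullet> z)" for z
    by (simp add: lower_feasible_def row_matrix_def matrix_vector_mult_def inner_vec_def)
  have "g \<in> convex_cone hull (a ` active_set a b (x, y))"
  proof (rule Farkas_convex_cone_hull)
    fix d assume d: "\<And>w. w \<in> a ` active_set a b (x, y) \<Longrightarrow> 0 \<le> w \<bullet> d"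
    show "0 \<le> g \<bullet> d"
    proof (rule minimizer_over_polyhedron_derivative_nonneg[OF finite[of UNIV] _ _ g])
      show "b j x \<le> a j \<bullet> y" for j
        using y feas by (simp add: lower_solutions_def is_arg_min_def)
      show "f (x, y) \<le> f (x, z)" if "\<And>j. j \<in> UNIV \<Longrightarrow> b j x \<le> a j \<bullet> z" for z
        using y feas[of z] that by (auto simp: lower_solutions_def is_arg_min_linorder)
      show "0 \<le> a j \<bullet> d" if "a j \<bullet> y = b j x" for j
        using d that by (auto simp: active_set_def)
    qed
  qed simp
  with gradient_eq[OF g] show ?thesis by simp
qed

section \<open>Basis index sets\<close>

lemma basis_sets_iff:
  "J \<in> basis_sets a \<longleftrightarrow> card J = dim (range a) \<and> dim (a ` J) = card J"
  for a :: "'m::finite \<Rightarrow> real^'p"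
proof -
  have "rows (row_matrix a) = range a"
    by (auto simp: rows_def row_def row_matrix_def)
  moreover have "dim (range a) \<le> CARD('p)"
    using dim_subset_UNIV[of "range a"] by simp
  ultimately show ?thesis
    by (auto simp: basis_sets_def submatrix_rank_def row_rank_def)
qed

text \<open>
  The Steinitz exchange step. It is carried out on vectors, where independence is a notion for sets,
  and then transferred to indices by choosing for each basis vector one index \<open>\<sigma> w\<close>; this also takes
  care of repeated rows. Vectors of \<open>B\<close> get their index from \<open>I\<close>, so that in the application below
  they carry multipliers of active constraints.
\<close>

lemma exchange_into_basis_set:
  fixes a :: "'m::finite \<Rightarrow> real^'p"
  assumes J': "J' \<in> basis_sets a" and B: "independent B" "B \<subseteq> a ` I"
  obtains J \<sigma> where "J \<in> basis_sets a" "J \<subseteq> I \<union> J'" "inj_on \<sigma> B" "\<sigma> ` B \<subseteq> J \<inter> I"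
    "\<And>w. w \<in> B \<Longrightarrow> a (\<sigma> w) = w"
proof -
  obtain C where C: "B \<subseteq> C" "C \<subseteq> B \<union> a ` J'" "independent C" "B \<union> a ` J' \<subseteq> span C"
    by (rule maximal_independent_subset_extend[of B "B \<union> a ` J'"]) (use B in auto)
  have "dim (range a) \<le> dim (a ` J')" using J' by (simp add: basis_sets_iff)
  then have "span (a ` J') = span (range a)"
    by (intro dim_eq_span) auto
  moreover have "span (a ` J') \<subseteq> span C"
    using C(4) by (intro span_minimal) auto
  moreover have "span C \<subseteq> span (range a)"
    using C(2) B(2) by (intro span_mono) blast
  ultimately have "dim (range a) = card C"
    using dim_eq_card[of C "range a"] C(3) by auto
  \<comment> \<open>A vector of \<open>B\<close> may also be a row with index in \<open>J'\<close>; membership in \<open>B\<close> takes precedence.\<close>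
  have "\<forall>w\<in>C. \<exists>j. a j = w \<and> j \<in> (if w \<in> B then I else J')"
    using C(2) B(2) by auto
  then obtain \<sigma> where \<sigma>: "\<And>w. w \<in> C \<Longrightarrow> a (\<sigma> w) = w \<and> \<sigma> w \<in> (if w \<in> B then I else J')"
    by metis
  have inj: "inj_on \<sigma> C" by (metis \<sigma> inj_onI)
  have "a ` \<sigma> ` C = C" using \<sigma> by force
  with inj \<open>dim (range a) = card C\<close> C(3) have "\<sigma> ` C \<in> basis_sets a"
    by (simp add: basis_sets_iff card_image dim_eq_card_independent)
  moreover have "\<sigma> ` C \<subseteq> I \<union> J'" using \<sigma> by (force split: if_splits)
  moreover have "\<sigma> ` B \<subseteq> \<sigma> ` C \<inter> I" using \<sigma> C(1) by force
  ultimately show thesis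
    using that inj_on_subset[OF inj C(1)] \<sigma> C(1) by blast
qed

section \<open>Covering the bilevel feasible set by branches\<close>

text \<open>
  The active rows that represent the gradient are completed to a basis by rows from \<open>J'\<close>. Only indices of active constraints carry a nonzero multiplier, which gives
  complementarity.
\<close>

lemma bilevel_feasible_in_KKT_set:
  fixes f :: "(real^'n) \<times> (real^'p) \<Rightarrow> real" and a :: "'m::finite \<Rightarrow> real^'p"
  assumes f: "real_polynomial_function f"
    and z: "z \<in> bilevel_feasible f I\<^sub>1 h a b"
    and J': "J' \<in> basis_sets a"
  obtains J where "J \<in> basis_sets a" "J \<subseteq> active_set a b z \<union> J'" "z \<in> KKT_set f I\<^sub>1 h a b J"
proof -
  obtain x y where xy: "z = (x, y)" by (cases z)
  let ?I = "active_set a b (x, y)" and ?g = "gradient (\<lambda>z. f (x, z)) y"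
  have "?g \<in> convex_cone hull (a ` ?I)"
    using z by (intro lower_solution_gradient_in_active_cone[OF f]) (simp add: bilevel_feasible_def xy)
  with convex_cone_hull_finite_subset[of "a ` ?I"]
  obtain c0 where "?g = (\<Sum>w\<in>a ` ?I. c0 w *\<^sub>R w)" "\<forall>w\<in>a ` ?I. 0 \<le> c0 w" by auto
  with conic_combination_independent[of "a ` ?I" c0]
  have "\<exists>B c. B \<subseteq> a ` ?I \<and> independent B \<and> (\<forall>w\<in>B. 0 \<le> c w) \<and> ?g = (\<Sum>w\<in>B. c w *\<^sub>R w)"
    by simp
  then obtain B c where B: "B \<subseteq> a ` ?I" "independent B" and c: "\<And>w. w \<in> B \<Longrightarrow> 0 \<le> c w"
    and g: "?g = (\<Sum>w\<in>B. c w *\<^sub>R w)" by blast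
  obtain J \<sigma> where J: "J \<in> basis_sets a" "J \<subseteq> ?I \<union> J'" and \<sigma>: "inj_on \<sigma> B" "\<sigma> ` B \<subseteq> J \<inter> ?I"
    "\<And>w. w \<in> B \<Longrightarrow> a (\<sigma> w) = w"
    using exchange_into_basis_set[OF J' B(2,1)] by metis
  define \<mu> where "\<mu> j = (if j \<in> \<sigma> ` B then c (a j) else 0)" for j
  have "(\<Sum>j\<in>J. \<mu> j *\<^sub>R a j) = (\<Sum>j\<in>\<sigma> ` B. \<mu> j *\<^sub>R a j)"
    using \<sigma>(2) by (intro sum.mono_neutral_right) (auto simp: \<mu>_def)
  also have "\<dots> = (\<Sum>w\<in>B. c w *\<^sub>R w)"
    using \<sigma> by (simp add: sum.reindex \<mu>_def)
  finally have eq: "?g - (\<Sum>j\<in>J. \<mu> j *\<^sub>R a j) = 0" using g by simp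
  have U: "(x, y) \<in> constraint_set I\<^sub>1 h a b"
    using z by (simp add: bilevel_feasible_def xy)
  have "\<mu> j \<ge> 0 \<and> \<mu> j * (a j \<bullet> y - b j x) = 0" for j
    using c \<sigma> by (auto simp: \<mu>_def active_set_def)
  with eq U have "z \<in> KKT_set f I\<^sub>1 h a b J"
    by (auto simp: KKT_set_def xy constraint_set_def intro!: exI[of _ \<mu>])
  with J that show thesis by (simp add: xy)
qed

lemma active_set_locally_subset:
  fixes a :: "'m::finite \<Rightarrow> real^'p" and b :: "'m \<Rightarrow> real^'n \<Rightarrow> real"
  assumes "\<And>j. continuous_on UNIV (b j)"
  obtains r where "r > 0" "\<And>z. z \<in> cball w r \<Longrightarrow> active_set a b z \<subseteq> active_set a b w"
proof -
  let ?U = "\<Inter>j\<in>- active_set a b w. {z. a j \<bullet> snd z \<noteq> b j (fst z)}"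
  have "continuous_on UNIV (\<lambda>z. b j (fst z))" for j :: 'm
    by (rule continuous_on_compose2[OF assms]) (auto intro: continuous_intros)
  then have "open ?U"
    by (intro open_INT finite ballI open_Collect_neq continuous_intros) auto
  moreover have "w \<in> ?U" by (auto simp: active_set_def)
  ultimately obtain r where "r > 0" "cball w r \<subseteq> ?U"
    by (meson open_contains_cball)
  then show thesis
    using that[of r] by (fastforce simp: active_set_def)
qed

theorem theorem3p5:
  fixes F f :: "(real^'n) \<times> (real^'p) \<Rightarrow> real"
    and I\<^sub>1 :: "'i set"
    and h :: "'i \<Rightarrow> (real^'n) \<times> (real^'p) \<Rightarrow> real"
    and a :: "'m::finite \<Rightarrow> real^'p"
    and b :: "'m \<Rightarrow> real^'n \<Rightarrow> real"
    and u :: "real^'n" and v :: "real^'p"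
  assumes "finite I\<^sub>1"
    and "real_polynomial_function F"
    and "real_polynomial_function f"
    and "\<And>i. i \<in> I\<^sub>1 \<Longrightarrow> real_polynomial_function (h i)"
    and "\<And>j. real_polynomial_function (b j)"
    and "\<And>x. (\<exists>y. (x, y) \<in> constraint_set I\<^sub>1 h a b) \<Longrightarrow> lower_solutions f a b x \<noteq> {}"
    and "(u, v) \<in> bilevel_feasible f I\<^sub>1 h a b"
  shows "\<exists>\<rho>\<^sub>0>0. \<forall>\<rho>. 0 < \<rho> \<and> \<rho> \<le> \<rho>\<^sub>0 \<longrightarrow>
    (\<forall>J' \<in> basis_sets a. (u, v) \<in> KKT_set f I\<^sub>1 h a b J' \<longrightarrow>
      (\<forall>J \<in> basis_sets a. J \<subseteq> active_set a b (u, v) \<union> J' \<longrightarrow>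
         branch_value F f I\<^sub>1 h a b \<rho> (u, v) J \<ge> 0) \<longrightarrow>
      local_minimizer F (bilevel_feasible f I\<^sub>1 h a b) (u, v))"
proof -
  have "continuous_on UNIV (b j)" for j
    using assms(5) by (simp add: continuous_on_polymonial_function real_polynomial_function_eq)
  then obtain r where r: "r > 0"
    "\<And>z. z \<in> cball (u, v) r \<Longrightarrow> active_set a b z \<subseteq> active_set a b (u, v)"
    using active_set_locally_subset by metis
  show ?thesis
  proof (intro exI[of _ r] conjI allI ballI impI)
    show "r > 0" by fact
  next
    fix \<rho> J'
    assume \<rho>: "0 < \<rho> \<and> \<rho> \<le> r" and J': "J' \<in> basis_sets a"
      and branch: "\<forall>J \<in> basis_sets a. J \<subseteq> active_set a b (u, v) \<union> J' \<longrightarrow>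
         branch_value F f I\<^sub>1 h a b \<rho> (u, v) J \<ge> 0"
    have "F (u, v) \<le> F z" if z: "z \<in> bilevel_feasible f I\<^sub>1 h a b" "z \<in> cball (u, v) \<rho>" for z
    proof -
      obtain J where J: "J \<in> basis_sets a" "J \<subseteq> active_set a b z \<union> J'"
        "z \<in> KKT_set f I\<^sub>1 h a b J"
        using bilevel_feasible_in_KKT_set[OF assms(3) z(1) J'] by blast
      have "active_set a b z \<subseteq> active_set a b (u, v)"
        using z(2) \<rho> by (intro r(2)) auto
      with J branch have "0 \<le> branch_value F f I\<^sub>1 h a b \<rho> (u, v) J" by blast
      also have "\<dots> \<le> ereal (F z - F (u, v))"
        unfolding branch_value_def using J(3) z(2) by (intro INF_lower) simp
      finally show ?thesis by simp
    qed
    then show "local_minimizer F (bilevel_feasible f I\<^sub>1 h a b) (u, v)"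
      using \<rho> assms(7) by (auto simp: local_minimizer_def is_arg_min_linorder intro!: exI[of _ \<rho>])
  qed
qed

end
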